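(* Let $d$ be a nonnegative integer and let $V$ be a finite dimensional $U_q(\widehat{\mathfrak{sl}}_2)$-module. Then the following are equivalent: (i) $V$ is basic of diameter $d$; (ii) $(K_0K_1-I)V=0$, the action of $K_0$ on $V$ is diagonalizable, and the set of distinct eigenvalues of $K_0$ on $V$ is $\{q^{2i-d}\mid 0\le i\le d\}$.
   Context: $\mathbb{K}$ is an algebraically closed field and $q\in\mathbb{K}$ is a fixed nonzero scalar that is not a root of unity. Write $[n]=\frac{q^n-q^{-n}}{q-q^{-1}}$ for $n=0,1,\ldots$. The quantum affine algebra $U_q(\widehat{\mathfrak{sl}}_2)$ is the unital associative $\mathbb{K}$-algebra with generators (the Chevalley generators) $e_i^{\pm}$, $K_i^{\pm1}$, $i\in\{0,1\}$, and relations: $K_iK_i^{-1}=K_i^{-1}K_i=1$; $K_0K_1=K_1K_0$; $K_ie_i^{\pm}K_i^{-1}=q^{\pm2}e_i^{\pm}$; $K_ie_j^{\pm}K_i^{-1}=q^{\mp2}e_j^{\pm}$ for $i\ne j$; $e_i^+e_i^--e_i^-e_i^+=\frac{K_i-K_i^{-1}}{q-q^{-1}}$; $e_0^{\pm}e_1^{\mp}=e_1^{\mp}e_0^{\pm}$; and $(e_i^{\pm})^3e_j^{\pm}-[3](e_i^{\pm})^2e_j^{\pm}e_i^{\pm}+[3]e_i^{\pm}e_j^{\pm}(e_i^{\pm})^2-e_j^{\pm}(e_i^{\pm})^3=0$ for $i\neq j$. A decomposition of a vector space $V$ over $\mathbb{K}$ of finite positive dimension is a sequence $U_0,\ldots,U_d$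 of nonzero subspaces of $V$ whose sum is direct and equals $V$. Consider data consisting of a decomposition $U_0,\ldots,U_d$ of $V$, the linear map $K:V\to V$ acting on $U_i$ as $q^{2i-d}$ times the identity ($0\le i\le d$), and linear maps $R,L:V\to V$ such that: (a) $RU_i\subseteq U_{i+1}$ for $0\le i\le d-1$ and $RU_d=0$; (b) $LU_i\subseteq U_{i-1}$ for $1\le i\le d$ and $LU_0=0$; (c) for every integer $0\le i\le d/2$ the restriction $R^{d-2i}|_{U_i}:U_i\to U_{d-i}$ is a bijection; (d) for every integer $0\le i\le d/2$ the restriction $L^{d-2i}|_{U_{d-i}}:U_{d-i}\to U_i$ is a bijection; (e) $R^3L-[3]R^2LR+[3]RLR^2-LR^3=0$; (f) $L^3R-[3]L^2RL+[3]LRL^2-RL^3=0$. For such data there is a unique $U_q(\widehat{\mathfrak{sl}}_2)$-module structure on $V$ for which $e_1^-,e_0^-,K_0,K_1$ act as $R,L,K,K^{-1}$ respectively; call it the module structure attached to the data. A finite dimensional $U_q(\widehat{\mathfrak{sl}}_2)$-module $V$ is called basic of diameter $d$ if there exist a decomposition $U_0,\ldots,U_d$ of $V$ and linear maps $R,L$ satisfying (a)--(f) such that the given module structure on $V$ agrees with the module structure attached to these data. *)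

theory Defs
  imports
    "HOL-Library.Poly_Mapping"
    "HOL-Algebra.QuotRing"
    "HOL-Algebra.Algebraic_Closure_Type"
    "HOL-Computational_Algebra.Polynomial"
begin

section \<open>The quantum affine algebra of sl2\<close>

definition q_number :: "'k::field \<Rightarrow> nat \<Rightarrow> 'k" where
  "q_number q n = (q ^ n - inverse q ^ n) / (q - inverse q)"

datatype node = N0 | N1

datatype pm = Pos | Neg

text \<open>
  \<open>E Pos i\<close>, \<open>E Neg i\<close> stand for the Chevalley generators $e_i^+$, $e_i^-$, and
  \<open>K Pos i\<close>, \<open>K Neg i\<close> for $K_i$, $K_i^{-1}$.
\<close>

datatype chevalley = E pm node | K pm node

text \<open>
  The wrapper makes the free monoid on the generators an additive monoid under concatenation,
  so that the product of finitely supported functions on words is the convolution product of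
  the free associative algebra.
\<close>

datatype 'g word = Word (letters: "'g list")

instantiation word :: (type) monoid_add
begin

definition "0 = Word []"
definition "v + w = Word (letters v @ letters w)"

instance
  by standard (simp_all add: zero_word_def plus_word_def)

end

type_synonym 'k free_alg = "chevalley word \<Rightarrow>\<^sub>0 'k"

definition gen :: "chevalley \<Rightarrow> 'k::field free_alg" where
  "gen g = Poly_Mapping.single (Word [g]) 1"

definition scalar :: "'k::field \<Rightarrow> 'k free_alg" where
  "scalar c = Poly_Mapping.single 0 c"

fun pm_power :: "'k::field \<Rightarrow> pm \<Rightarrow> 'k" where
  "pm_power x Pos = x"
| "pm_power x Neg = inverse x"

text \<open>A relation $a = b$ is represented by the element $a - b$ of the free algebra.\<close>

definition uq_relators :: "'k::field \<Rightarrow> 'k free_alg set" where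
  "uq_relators q =
     {gen (K Pos i) * gen (K Neg i) - 1 | i. True}
   \<union> {gen (K Neg i) * gen (K Pos i) - 1 | i. True}
   \<union> {gen (K Pos N0) * gen (K Pos N1) - gen (K Pos N1) * gen (K Pos N0)}
   \<union> {gen (K Pos i) * gen (E s i) * gen (K Neg i)
        - scalar ((pm_power q s)\<^sup>2) * gen (E s i) | s i. True}
   \<union> {gen (K Pos i) * gen (E s j) * gen (K Neg i)
        - scalar ((pm_power (inverse q) s)\<^sup>2) * gen (E s j) | s i j. i \<noteq> j}
   \<union> {gen (E Pos i) * gen (E Neg i) - gen (E Neg i) * gen (E Pos i)
        - scalar (inverse (q - inverse q)) * (gen (K Pos i) - gen (K Neg i)) | i. True}
   \<union> {gen (E Pos N0) * gen (E Neg N1) - gen (E Neg N1) * gen (E Pos N0),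
      gen (E Neg N0) * gen (E Pos N1) - gen (E Pos N1) * gen (E Neg N0)}
   \<union> {gen (E s i) ^ 3 * gen (E s j)
        - scalar (q_number q 3) * (gen (E s i) ^ 2 * gen (E s j) * gen (E s i))
        + scalar (q_number q 3) * (gen (E s i) * gen (E s j) * gen (E s i) ^ 2)
        - gen (E s j) * gen (E s i) ^ 3 | s i j. i \<noteq> j}"

abbreviation free_ring :: "'k::field free_alg ring" where
  "free_ring \<equiv> ring_of_type_algebra"

definition uq_ideal :: "'k::field \<Rightarrow> 'k free_alg set" where
  "uq_ideal q = genideal free_ring (uq_relators q)"

definition Uq :: "'k::field \<Rightarrow> 'k free_alg set ring" where
  "Uq q = free_ring Quot uq_ideal q"

definition uq_class :: "'k::field \<Rightarrow> 'k free_alg \<Rightarrow> 'k free_alg set" where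
  "uq_class q x = uq_ideal q +>\<^bsub>free_ring\<^esub> x"

abbreviation uq_gen :: "'k::field \<Rightarrow> chevalley \<Rightarrow> 'k free_alg set" where
  "uq_gen q g \<equiv> uq_class q (gen g)"


section \<open>Modules\<close>

definition (in vector_space) fin_dim :: bool where
  "fin_dim \<longleftrightarrow> (\<exists>B. finite B \<and> span B = UNIV)"

text \<open>
  Unital left modules over the \<open>'a\<close>-algebra \<open>Uq q\<close> whose underlying vector space is the given
  one. Linearity of each \<open>act u\<close> over \<open>'a\<close> is a consequence: scalars are central in \<open>Uq q\<close>.
  The values of \<open>act\<close> outside the carrier are irrelevant.
\<close>

definition (in vector_space) uq_module :: "'a \<Rightarrow> ('a free_alg set \<Rightarrow> 'b \<Rightarrow> 'b) \<Rightarrow> bool" where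
  "uq_module q act \<longleftrightarrow>
     (\<forall>u \<in> carrier (Uq q). \<forall>v w. act u (v + w) = act u v + act u w) \<and>
     (\<forall>u \<in> carrier (Uq q). \<forall>u' \<in> carrier (Uq q). \<forall>v.
        act (u \<oplus>\<^bsub>Uq q\<^esub> u') v = act u v + act u' v) \<and>
     (\<forall>u \<in> carrier (Uq q). \<forall>u' \<in> carrier (Uq q). \<forall>v.
        act (u \<otimes>\<^bsub>Uq q\<^esub> u') v = act u (act u' v)) \<and>
     (\<forall>v. act \<one>\<^bsub>Uq q\<^esub> v = v) \<and>
     (\<forall>c v. act (uq_class q (scalar c)) v = scale c v)"

text \<open>
  Only \<open>U i\<close> with \<open>i \<le> d\<close> matter. The last conjunct says that the sum of the
  \<open>U i\<close> is direct and equals the whole space.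
\<close>

definition (in vector_space) decomposition :: "nat \<Rightarrow> (nat \<Rightarrow> 'b set) \<Rightarrow> bool" where
  "decomposition d U \<longleftrightarrow>
     (\<forall>i\<le>d. subspace (U i) \<and> U i \<noteq> {0}) \<and>
     (\<forall>v. \<exists>!u. u \<in> (\<Pi>\<^sub>E i\<in>{..d}. U i) \<and> (\<Sum>i\<le>d. u i) = v)"

text \<open>\<open>Km\<close>, \<open>R\<close>, \<open>L\<close> are the linear maps $K$, $R$, $L$.\<close>

definition (in vector_space) basic_data ::
  "'a \<Rightarrow> nat \<Rightarrow> (nat \<Rightarrow> 'b set) \<Rightarrow> ('b \<Rightarrow> 'b) \<Rightarrow> ('b \<Rightarrow> 'b) \<Rightarrow> ('b \<Rightarrow> 'b) \<Rightarrow> bool" where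
  "basic_data q d U Km R L \<longleftrightarrow>
     decomposition d U \<and>
     Vector_Spaces.linear scale scale Km \<and>
     Vector_Spaces.linear scale scale R \<and>
     Vector_Spaces.linear scale scale L \<and>
     (\<forall>i\<le>d. \<forall>v\<in>U i. Km v = scale (q powi (2 * int i - int d)) v) \<and>
     (\<forall>i<d. R ` U i \<subseteq> U (i + 1)) \<and> R ` U d = {0} \<and>
     (\<forall>i. 1 \<le> i \<and> i \<le> d \<longrightarrow> L ` U i \<subseteq> U (i - 1)) \<and> L ` U 0 = {0} \<and>
     (\<forall>i. 2 * i \<le> d \<longrightarrow> bij_betw (R ^^ (d - 2 * i)) (U i) (U (d - i))) \<and>
     (\<forall>i. 2 * i \<le> d \<longrightarrow> bij_betw (L ^^ (d - 2 * i)) (U (d - i)) (U i)) \<and>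
     (\<forall>v. R (R (R (L v))) - scale (q_number q 3) (R (R (L (R v))))
            + scale (q_number q 3) (R (L (R (R v)))) - L (R (R (R v))) = 0) \<and>
     (\<forall>v. L (L (L (R v))) - scale (q_number q 3) (L (L (R (L v))))
            + scale (q_number q 3) (L (R (L (L v)))) - R (L (L (L v))) = 0)"

text \<open>
  The module structure attached to the data is the unique one satisfying this predicate, so
  a given module structure agrees with it iff the given structure satisfies the predicate.
\<close>

definition (in vector_space) attached_module ::
  "'a \<Rightarrow> ('b \<Rightarrow> 'b) \<Rightarrow> ('b \<Rightarrow> 'b) \<Rightarrow> ('b \<Rightarrow> 'b) \<Rightarrow> ('a free_alg set \<Rightarrow> 'b \<Rightarrow> 'b) \<Rightarrow> bool" where
  "attached_module q Km R L act \<longleftrightarrow>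
     uq_module q act \<and>
     act (uq_gen q (E Neg N1)) = R \<and>
     act (uq_gen q (E Neg N0)) = L \<and>
     act (uq_gen q (K Pos N0)) = Km \<and>
     act (uq_gen q (K Pos N1)) = inv_into UNIV Km"

definition (in vector_space) basic :: "'a \<Rightarrow> nat \<Rightarrow> ('a free_alg set \<Rightarrow> 'b \<Rightarrow> 'b) \<Rightarrow> bool" where
  "basic q d act \<longleftrightarrow>
     (\<exists>U Km R L. basic_data q d U Km R L \<and> attached_module q Km R L act)"

definition (in vector_space) diagonalizable :: "('b \<Rightarrow> 'b) \<Rightarrow> bool" where
  "diagonalizable f \<longleftrightarrow>
     (\<exists>B. independent B \<and> span B = UNIV \<and> (\<forall>b\<in>B. \<exists>c. f b = scale c b))"

definition (in vector_space) eigenvalues :: "('b \<Rightarrow> 'b) \<Rightarrow> 'a set" where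
  "eigenvalues f = {c. \<exists>v. v \<noteq> 0 \<and> f v = scale c v}"

end

theory Submission
  imports Defs
begin

text \<open>
  That a basic module has the stated spectrum is linear algebra: the given decomposition is the
  decomposition into eigenspaces of \<open>K\<^sub>0\<close>, and \<open>K\<^sub>1\<close> acts as the inverse of \<open>K\<^sub>0\<close> by definition.

  Conversely, let \<open>K\<^sub>0\<close> be diagonalizable with eigenvalues \<open>q\<^bsup>2 i - d\<^esup>\<close>, let \<open>K\<^sub>1\<close> act as its
  inverse, and let \<open>U i\<close> be the eigenspaces. The defining relations say that \<open>R = e\<^sub>1\<^sup>-\<close>
  raises and \<open>L = e\<^sub>0\<^sup>-\<close> lowers the index, and that \<open>R\<close> and \<open>L\<close> satisfy the q-Serre relations.
  What remains is the bijectivity of \<open>R\<^bsup>d - 2 i\<^esup> : U i \<rightarrow> U (d - i)\<close> and of the corresponding power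
  of \<open>L\<close>. Each is a statement about one of the two subalgebras \<open>U\<^sub>q(sl\<^sub>2)\<close>, generated by
  \<open>e\<^sub>i\<^sup>+\<close>, \<open>e\<^sub>i\<^sup>-\<close>, \<open>K\<^sub>i\<close>, \<open>K\<^sub>i\<^sup>-\<^sup>1\<close>: with \<open>e\<close>, \<open>f\<close> for the raising and lowering operator of this
  subalgebra and \<open>W n\<close> for its space of weight \<open>n\<close>, the power \<open>f\<^sup>m\<close> maps \<open>W m\<close> bijectively
  onto \<open>W (- m)\<close> (lemma \<open>f_pow_bij_betw_weight_spaces\<close>).

  On \<open>W m\<close> the operator \<open>e\<^sup>m f\<^sup>m\<close> is a product of
  factors \<open>C - \<gamma> l\<close> with \<open>\<bar>l\<bar> < m\<close>, where \<open>C\<close> is the Casimir element and \<open>\<gamma> (n + 1)\<close> its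
  value on a highest weight vector of weight \<open>n\<close>. The central element \<open>C\<close> cannot have the eigenvalue
  \<open>\<gamma> l\<close> on \<open>W m\<close>, because an eigenvector could be moved by a power of \<open>e\<close> to a highest weight vector of
  some weight \<open>n \<ge> m\<close> with the same value of \<open>C\<close>, while \<open>\<gamma> l = \<gamma> (n + 1)\<close> only for
  \<open>\<bar>l\<bar> = \<bar>n + 1\<bar>\<close>, as \<open>q\<close> is not a root of unity (lemma \<open>casimir_eigenvector_zero\<close>). Therefore \<open>e\<^sup>m f\<^sup>m\<close> is injective on \<open>W m\<close>,
  and \<open>f\<^sup>m e\<^sup>m\<close> on \<open>W (- m)\<close> by symmetry; in finite dimension this gives the bijections.
\<close>

section \<open>Powers of a scalar that is not a root of unity\<close>

lemma powi_inject_of_not_root_of_unity: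
  fixes q :: "'k::field"
  assumes q0: "q \<noteq> 0" and nr: "\<And>n::nat. n > 0 \<Longrightarrow> q ^ n \<noteq> 1"
  shows "q powi m = q powi n \<longleftrightarrow> m = n"
proof
  have *: "\<not> a < b" if "q powi a = q powi b" for a b
  proof
    assume "a < b"
    have "q powi (b - a) = 1"
      using that q0 by (simp add: power_int_diff)
    moreover have "q powi (b - a) = q ^ nat (b - a)"
      using \<open>a < b\<close> by (simp add: power_int_def)
    ultimately show False
      using nr[of "nat (b - a)"] \<open>a < b\<close> by simp
  qed
  assume "q powi m = q powi n"
  then show "m = n"
    using *[of m n] *[of n m] by simp
qed simp

text \<open>The equation \<open>x + 1 / x = y + 1 / y\<close> forces \<open>x = y\<close> or \<open>x y = 1\<close>.\<close>

lemma powi_sum_inject_of_not_root_of_unity: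
  fixes q :: "'k::field"
  assumes q0: "q \<noteq> 0" and nr: "\<And>n::nat. n > 0 \<Longrightarrow> q ^ n \<noteq> 1"
    and eq: "q powi m + q powi (- m) = q powi n + q powi (- n)"
  shows "m = n \<or> m = - n"
proof -
  define x y where "x = q powi m" and "y = q powi n"
  have nz: "x \<noteq> 0" "y \<noteq> 0"
    using q0 by (auto simp: x_def y_def)
  have "x + inverse x = y + inverse y"
    using eq by (simp add: x_def y_def power_int_minus)
  moreover have "(x - y) * (x * y - 1) = x * y * ((x + inverse x) - (y + inverse y))"
    using nz by (simp add: field_simps)
  ultimately have "x = y \<or> x * y = 1"
    by simp
  then have "x = y \<or> x = inverse y"
    using nz by (auto simp: field_simps)
  then have "q powi m = q powi n \<or> q powi m = q powi (- n)"
    by (simp add: x_def y_def power_int_minus)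
  then show ?thesis
    using powi_inject_of_not_root_of_unity[OF q0 nr] by simp
qed


section \<open>Linear algebra of eigenspaces\<close>

lemma (in vector_space) injective_endomorphism_of_subspace_surj:
  assumes "fin_dim" "subspace S" "Vector_Spaces.linear scale scale g"
    and maps: "g ` S \<subseteq> S" and inj: "\<And>v. v \<in> S \<Longrightarrow> g v = 0 \<Longrightarrow> v = 0"
  shows "g ` S = S"
proof -
  obtain B where "finite B" "span B = UNIV"
    using assms(1) by (auto simp: fin_dim_def)
  then obtain B' where B': "B' \<subseteq> B" "independent B'" "span B' = UNIV"
    by (metis maximal_independent_subset span_mono span_span top.extremum_uniqueI)
  interpret finite_dimensional_vector_space scale B'
    using B' \<open>finite B\<close> by unfold_locales (auto intro: finite_subset)
  interpret finite_dimensional_vector_space_pair_1 scale B' scale ..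
  interpret g: Vector_Spaces.linear scale scale g by fact
  have "inj_on g (span S)"
    using assms(2) inj
    by (auto simp: span_eq_iff[THEN iffD2] inj_on_def) (metis eq_iff_diff_eq_0 g.diff subspace_diff)
  then have "dim (g ` S) = dim S"
    by (rule dim_image_eq[OF assms(3)])
  then show ?thesis
    using subspace_dim_equal[of "g ` S" S] g.subspace_image[OF assms(2)] assms(2) maps by simp
qed


context vector_space
begin

text \<open>
  Eigenspaces for distinct eigenvalues are independent: applying \<open>f - c j\<close> to the sum removes
  the summand of index \<open>j\<close> and multiplies every other one by the nonzero scalar \<open>c i - c j\<close>.
\<close>

lemma eigenvectors_sum_zero:
  assumes f: "Vector_Spaces.linear scale scale f" and "finite I" "inj_on c I"
    and "\<And>i. i \<in> I \<Longrightarrow> f (u i) = scale (c i) (u i)"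
    and "(\<Sum>i\<in>I. u i) = 0"
  shows "\<forall>i\<in>I. u i = 0"
  using assms(2-)
proof (induction I arbitrary: u rule: finite_induct)
  case (insert j I)
  interpret f: Vector_Spaces.linear scale scale f by (rule f)
  have "(\<Sum>i\<in>I. scale (c i - c j) (u i)) = (\<Sum>i\<in>insert j I. scale (c i - c j) (u i))"
    using insert.hyps by simp
  also have "\<dots> = f (\<Sum>i\<in>insert j I. u i) - scale (c j) (\<Sum>i\<in>insert j I. u i)"
    unfolding f.sum scale_sum_right sum_subtractf[symmetric]
    by (intro sum.cong) (simp_all add: insert.prems(2) scale_left_diff_distrib)
  also have "\<dots> = 0"
    using insert.prems(3) by (simp add: f.zero)
  finally have "\<forall>i\<in>I. scale (c i - c j) (u i) = 0"
    using insert.IH[of "\<lambda>i. scale (c i - c j) (u i)"] insert.prems(1,2)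
    by (simp add: f.scale scale_left_commute inj_on_def)
  moreover have "c i \<noteq> c j" if "i \<in> I" for i
    using that insert.prems(1) insert.hyps(2) by (auto simp: inj_on_def)
  ultimately have "\<forall>i\<in>I. u i = 0"
    by auto
  then show ?case
    using insert.prems(3) insert.hyps by simp
qed simp

lemma decomposition_eigenspaces:
  assumes f: "Vector_Spaces.linear scale scale f" and c: "inj_on c {..d}"
    and diag: "diagonalizable f" and eig: "eigenvalues f = c ` {..d}"
  shows "decomposition d (\<lambda>i. {v. f v = scale (c i) v})"
proof -
  interpret f: Vector_Spaces.linear scale scale f by (rule f)
  define U where "U i = {v. f v = scale (c i) v}" for i
  have sub: "subspace (U i)" for i
    by (rule subspaceI) (simp_all add: U_def f.add f.scale f.zero scale_right_distrib scale_left_commute)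
  have nontrivial: "U i \<noteq> {0}" if "i \<le> d" for i
  proof -
    have "c i \<in> eigenvalues f"
      using that eig by simp
    then show ?thesis
      by (auto simp: eigenvalues_def U_def)
  qed
  let ?sums = "{v. \<exists>u \<in> (\<Pi>\<^sub>E i\<in>{..d}. U i). (\<Sum>i\<le>d. u i) = v}"
  have sums: "v \<in> ?sums" if "\<And>i. i \<le> d \<Longrightarrow> u i \<in> U i" "(\<Sum>i\<le>d. u i) = v" for u v
    using that by (intro CollectI bexI[of _ "restrict u {..d}"]) auto
  have sub_sums: "subspace ?sums"
  proof (rule subspaceI)
    show "0 \<in> ?sums"
      by (rule sums[of "\<lambda>_. 0"]) (use sub subspace_0 in auto)
  next
    fix x y assume "x \<in> ?sums" "y \<in> ?sums"
    then obtain u w where u: "u \<in> (\<Pi>\<^sub>E i\<in>{..d}. U i)" "w \<in> (\<Pi>\<^sub>E i\<in>{..d}. U i)"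
      "(\<Sum>i\<le>d. u i) = x" "(\<Sum>i\<le>d. w i) = y"
      by auto
    show "x + y \<in> ?sums"
      by (rule sums[of "\<lambda>i. u i + w i"])
        (use u sub in \<open>auto simp: sum.distrib PiE_iff intro: subspace_add\<close>)
  next
    fix a x assume "x \<in> ?sums"
    then obtain u where u: "u \<in> (\<Pi>\<^sub>E i\<in>{..d}. U i)" "(\<Sum>i\<le>d. u i) = x"
      by auto
    show "scale a x \<in> ?sums"
      by (rule sums[of "\<lambda>i. scale a (u i)"])
        (use u sub in \<open>auto simp: scale_sum_right PiE_iff intro: subspace_scale\<close>)
  qed
  obtain B where B: "independent B" "span B = UNIV" "\<forall>b\<in>B. \<exists>c. f b = scale c b"
    using diag by (auto simp: diagonalizable_def)
  have B_sums: "B \<subseteq> ?sums"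
  proof
    fix b assume "b \<in> B"
    then obtain a where a: "f b = scale a b" "b \<noteq> 0"
      using B dependent_zero by blast
    then have "a \<in> eigenvalues f"
      by (auto simp: eigenvalues_def)
    then obtain i where i: "i \<le> d" "a = c i"
      using eig by auto
    show "b \<in> ?sums"
      by (rule sums[of "\<lambda>j. if j = i then b else 0"])
        (use a i sub subspace_0 in \<open>auto simp: U_def f.zero\<close>)
  qed
  have ex: "?sums = UNIV"
    using span_minimal[OF B_sums sub_sums] unfolding B(2) by (rule top.extremum_uniqueI)
  have unique: "u = w" if "u \<in> (\<Pi>\<^sub>E i\<in>{..d}. U i)" "w \<in> (\<Pi>\<^sub>E i\<in>{..d}. U i)"
    "(\<Sum>i\<le>d. u i) = (\<Sum>i\<le>d. w i)" for u w
  proof -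
    have "\<forall>i\<in>{..d}. u i - w i = 0"
    proof (rule eigenvectors_sum_zero[OF f _ c])
      show "f (u i - w i) = scale (c i) (u i - w i)" if "i \<in> {..d}" for i
        using \<open>u \<in> _\<close> \<open>w \<in> _\<close> that
        by (auto simp: PiE_iff U_def f.diff scale_right_diff_distrib)
    qed (use that in \<open>simp_all add: sum_subtractf\<close>)
    then show ?thesis
      using that(1,2) by (intro PiE_ext) auto
  qed
  have "\<exists>!u. u \<in> (\<Pi>\<^sub>E i\<in>{..d}. U i) \<and> (\<Sum>i\<le>d. u i) = v" for v
    using ex unique by blast
  then have "decomposition d U"
    using sub nontrivial by (simp add: decomposition_def)
  then show ?thesis
    by (simp add: U_def[abs_def])
qed

text \<open>
  If \<open>v = \<Sum>i\<le>d. u i\<close> is an eigenvector for \<open>a\<close>, then \<open>\<Sum>i\<le>d. (c i - a) u i\<close> is zero, so by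
  uniqueness each summand is zero, and \<open>a = c i\<close> for any \<open>i\<close> with \<open>u i \<noteq> 0\<close>.
\<close>

lemma
  assumes dec: "decomposition d U" and f: "Vector_Spaces.linear scale scale f"
    and eigen: "\<And>i v. i \<le> d \<Longrightarrow> v \<in> U i \<Longrightarrow> f v = scale (c i) v"
  shows diagonalizable_of_decomposition: "diagonalizable f"
    and eigenvalues_of_decomposition: "eigenvalues f = c ` {..d}"
proof -
  interpret f: Vector_Spaces.linear scale scale f by (rule f)
  have sub: "subspace (U i)" and nontrivial: "U i \<noteq> {0}" if "i \<le> d" for i
    using dec that by (auto simp: decomposition_def)
  have ex1: "\<exists>!u. u \<in> (\<Pi>\<^sub>E i\<in>{..d}. U i) \<and> (\<Sum>i\<le>d. u i) = v" for v
    using dec by (auto simp: decomposition_def)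
  have "v \<in> span (\<Union>i\<le>d. U i)" for v
  proof -
    obtain u where "u \<in> (\<Pi>\<^sub>E i\<in>{..d}. U i)" and v: "(\<Sum>i\<le>d. u i) = v"
      using ex1[of v] by blast
    then have "u i \<in> span (\<Union>i\<le>d. U i)" if "i \<le> d" for i
      using that by (intro span_base) (auto simp: PiE_iff)
    then show ?thesis
      unfolding v[symmetric] by (intro span_sum) auto
  qed
  moreover obtain B where B: "B \<subseteq> (\<Union>i\<le>d. U i)" "independent B" "(\<Union>i\<le>d. U i) \<subseteq> span B"
    using maximal_independent_subset by blast
  ultimately have "span B = UNIV"
    by (metis UNIV_eq_I span_minimal subsetD subspace_span)
  then show "diagonalizable f"
    unfolding diagonalizable_def using B eigen by blast
  show "eigenvalues f = c ` {..d}"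
  proof
    show "c ` {..d} \<subseteq> eigenvalues f"
    proof
      fix a assume "a \<in> c ` {..d}"
      then obtain i where i: "i \<le> d" "a = c i"
        by auto
      then obtain v where "v \<in> U i" "v \<noteq> 0"
        using nontrivial[of i] subspace_0[OF sub[of i]] by blast
      then show "a \<in> eigenvalues f"
        using eigen i by (auto simp: eigenvalues_def)
    qed
    show "eigenvalues f \<subseteq> c ` {..d}"
    proof
      fix a assume "a \<in> eigenvalues f"
      then obtain v where v: "v \<noteq> 0" "f v = scale a v"
        by (auto simp: eigenvalues_def)
      obtain u where u: "u \<in> (\<Pi>\<^sub>E i\<in>{..d}. U i)" "(\<Sum>i\<le>d. u i) = v"
        using ex1[of v] by blast
      define w where "w = restrict (\<lambda>i. scale (c i - a) (u i)) {..d}"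
      have "(\<Sum>i\<le>d. w i) = f (\<Sum>i\<le>d. u i) - scale a (\<Sum>i\<le>d. u i)"
        unfolding f.sum scale_sum_right sum_subtractf[symmetric]
        using u(1) by (intro sum.cong)
          (auto simp: w_def eigen PiE_iff scale_left_diff_distrib)
      then have "(\<Sum>i\<le>d. w i) = 0"
        using u v by simp
      moreover have "w \<in> (\<Pi>\<^sub>E i\<in>{..d}. U i)"
        using u sub by (auto simp: w_def PiE_iff intro: subspace_scale)
      moreover have "restrict (\<lambda>_. 0) {..d} \<in> (\<Pi>\<^sub>E i\<in>{..d}. U i)"
        "(\<Sum>i\<le>d. restrict (\<lambda>_. 0) {..d} i) = 0"
        using sub by (auto intro: subspace_0)
      ultimately have "w = restrict (\<lambda>_. 0) {..d}"
        using ex1[of 0] by blast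
      then have zero: "scale (c i - a) (u i) = 0" if "i \<le> d" for i
        using that by (metis atMost_iff restrict_apply' w_def)
      have "\<exists>i\<le>d. u i \<noteq> 0"
        using u(2) v(1) by (metis atMost_iff sum.neutral)
      then show "a \<in> c ` {..d}"
        using zero by force
    qed
  qed
qed

end


section \<open>Actions of quantum sl2\<close>

text \<open>
  The operators \<open>e\<close>, \<open>f\<close>, \<open>k\<close>, \<open>k'\<close> are the actions of the Chevalley generators of
  \<open>U\<^sub>q(sl\<^sub>2)\<close>, with \<open>k'\<close> that of the inverse of \<open>k\<close>.
\<close>

locale qsl2_action = vector_space scale
  for scale :: "'a::field \<Rightarrow> 'b::ab_group_add \<Rightarrow> 'b" +
  fixes q :: 'a and e f k k' :: "'b \<Rightarrow> 'b"
  assumes q_nonzero: "q \<noteq> 0"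
    and not_root_of_unity: "\<And>n::nat. n > 0 \<Longrightarrow> q ^ n \<noteq> 1"
    and linear_e: "Vector_Spaces.linear scale scale e"
    and linear_f: "Vector_Spaces.linear scale scale f"
    and linear_k: "Vector_Spaces.linear scale scale k"
    and linear_k': "Vector_Spaces.linear scale scale k'"
    and k_k': "k (k' v) = v"
    and k'_k: "k' (k v) = v"
    and k_e: "k (e v) = scale (q\<^sup>2) (e (k v))"
    and k_f: "k (f v) = scale ((inverse q)\<^sup>2) (f (k v))"
    and e_f: "e (f v) - f (e v) = scale (inverse (q - inverse q)) (k v - k' v)"
begin

sublocale e: Vector_Spaces.linear scale scale e by (rule linear_e)
sublocale f: Vector_Spaces.linear scale scale f by (rule linear_f)
sublocale k: Vector_Spaces.linear scale scale k by (rule linear_k)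
sublocale k': Vector_Spaces.linear scale scale k' by (rule linear_k')

lemmas linearity =
  e.add e.diff e.scale e.zero f.add f.diff f.scale f.zero
  k.add k.diff k.scale k.zero k'.add k'.diff k'.scale k'.zero

lemma q_minus_inverse_nonzero: "q - inverse q \<noteq> 0"
proof
  assume "q - inverse q = 0"
  then have "q ^ 2 = 1"
    using q_nonzero by (simp add: power2_eq_square field_simps)
  then show False
    using not_root_of_unity[of 2] by simp
qed

lemma f_k: "f (k v) = scale (q\<^sup>2) (k (f v))"
  using q_nonzero by (simp add: k_f flip: power_mult_distrib)

lemma e_k': "e (k' v) = scale (q\<^sup>2) (k' (e v))"
proof -
  have "k (e (k' v)) = k (scale (q\<^sup>2) (k' (e v)))"
    by (simp add: k_e k_k' linearity)
  then show ?thesis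
    by (metis k'_k)
qed

lemma f_k': "f (k' v) = scale ((inverse q)\<^sup>2) (k' (f v))"
proof -
  have "k (f (k' v)) = k (scale ((inverse q)\<^sup>2) (k' (f v)))"
    by (simp add: k_f k_k' linearity)
  then show ?thesis
    by (metis k'_k)
qed

text \<open>
  The symmetry that exchanges the raising and the lowering operator; it sends weight \<open>n\<close>
  to weight \<open>- n\<close>, so that each statement about \<open>f\<close> has a mirror image about \<open>e\<close>.
\<close>

lemma swap: "qsl2_action scale q f e k' k"
proof unfold_locales
  fix v
  show "k' (f v) = scale (q\<^sup>2) (f (k' v))" "k' (e v) = scale ((inverse q)\<^sup>2) (e (k' v))"
    using q_nonzero by (simp_all add: f_k' e_k' flip: power_mult_distrib)
  have "f (e v) - e (f v) = - (e (f v) - f (e v))"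
    by simp
  also have "\<dots> = scale (inverse (q - inverse q)) (k' v - k v)"
    by (simp add: e_f scale_right_diff_distrib)
  finally show "f (e v) - e (f v) = scale (inverse (q - inverse q)) (k' v - k v)" .
qed (simp_all add: q_nonzero not_root_of_unity linearity k_k' k'_k)

definition weight_space :: "int \<Rightarrow> 'b set" where
  "weight_space n = {v. k v = scale (q powi n) v}"

lemma subspace_weight_space: "subspace (weight_space n)"
  by (rule subspaceI) (simp_all add: weight_space_def linearity scale_right_distrib scale_left_commute)

lemma k'_on_weight_space:
  assumes "v \<in> weight_space n"
  shows "k' v = scale (q powi (- n)) v"
proof -
  have "v = k' (scale (q powi n) v)"
    using assms k'_k[of v] by (simp add: weight_space_def)
  then have "scale (q powi (- n)) v = scale (q powi (- n) * q powi n) (k' v)"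
    by (metis k'.scale scale_scale)
  then show ?thesis
    using q_nonzero by (simp add: power_int_minus)
qed

lemma weight_space_swap: "qsl2_action.weight_space scale q k' n = weight_space (- n)"
proof -
  interpret swap: qsl2_action scale q f e k' k by (rule swap)
  show ?thesis
    using k'_on_weight_space[of _ "- n"] swap.k'_on_weight_space[of _ n]
    by (auto simp: weight_space_def swap.weight_space_def)
qed

lemma e_weight_space: "v \<in> weight_space n \<Longrightarrow> e v \<in> weight_space (n + 2)"
  using q_nonzero by (simp add: weight_space_def k_e linearity power_int_add mult.commute)

lemma f_weight_space: "v \<in> weight_space n \<Longrightarrow> f v \<in> weight_space (n - 2)"
  using q_nonzero
  by (simp add: weight_space_def k_f linearity power_int_diff power_inverse field_simps)

lemma e_pow_weight_space: "v \<in> weight_space n \<Longrightarrow> (e ^^ j) v \<in> weight_space (n + 2 * int j)"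
proof (induction j)
  case (Suc j)
  then show ?case
    using e_weight_space[of "(e ^^ j) v" "n + 2 * int j"] by (simp add: algebra_simps)
qed simp

lemma f_pow_weight_space: "v \<in> weight_space n \<Longrightarrow> (f ^^ j) v \<in> weight_space (n - 2 * int j)"
proof (induction j)
  case (Suc j)
  then show ?case
    using f_weight_space[of "(f ^^ j) v" "n - 2 * int j"] by (simp add: algebra_simps)
qed simp

lemma linear_f_pow: "Vector_Spaces.linear scale scale (f ^^ j)"
  by (induction j) (auto simp: Vector_Spaces.linear_iff vector_space_axioms linearity)

lemma linear_e_pow: "Vector_Spaces.linear scale scale (e ^^ j)"
  by (induction j) (auto simp: Vector_Spaces.linear_iff vector_space_axioms linearity)

text \<open>
  The quantum Casimir element of \<open>U\<^sub>q(sl\<^sub>2)\<close>. It is central, and on a weight space it differs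
  from \<open>e f\<close> and from \<open>f e\<close> by scalars.
\<close>

definition casimir :: "'b \<Rightarrow> 'b" where
  "casimir v = f (e v)
     + scale (inverse ((q - inverse q)\<^sup>2)) (scale q (k v) + scale (inverse q) (k' v))"

text \<open>The value of the Casimir element on a highest weight vector of weight \<open>l - 1\<close>.\<close>

definition casimir_scalar :: "int \<Rightarrow> 'a" where
  "casimir_scalar l = inverse ((q - inverse q)\<^sup>2) * (q powi l + q powi (- l))"

lemma casimir_scalar_inject:
  "casimir_scalar m = casimir_scalar n \<Longrightarrow> m = n \<or> m = - n"
  using powi_sum_inject_of_not_root_of_unity[OF q_nonzero not_root_of_unity, of m n]
    q_minus_inverse_nonzero
  by (simp add: casimir_scalar_def)

lemma casimir_swap: "qsl2_action.casimir scale q f e k' k v = casimir v"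
proof -
  interpret swap: qsl2_action scale q f e k' k by (rule swap)
  define c where "c = inverse (q - inverse q)"
  have c: "inverse ((q - inverse q)\<^sup>2) = c\<^sup>2"
    by (simp add: c_def power_inverse)
  have cq: "c\<^sup>2 * q - c\<^sup>2 * inverse q = c"
  proof -
    have "c\<^sup>2 * q - c\<^sup>2 * inverse q = c * (c * (q - inverse q))"
      by (simp add: power2_eq_square algebra_simps)
    then show ?thesis
      using q_minus_inverse_nonzero by (simp add: c_def)
  qed
  have "swap.casimir v - casimir v =
      (e (f v) - f (e v))
      + scale (c\<^sup>2) (scale q (k' v) + scale (inverse q) (k v))
      - scale (c\<^sup>2) (scale q (k v) + scale (inverse q) (k' v))"
    by (simp add: swap.casimir_def casimir_def c)
  also have "\<dots> = scale (c - (c\<^sup>2 * q - c\<^sup>2 * inverse q)) (k v)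
      - scale (c - (c\<^sup>2 * q - c\<^sup>2 * inverse q)) (k' v)"
    by (simp add: e_f c_def[symmetric] scale_right_distrib scale_right_diff_distrib
        scale_left_diff_distrib algebra_simps)
  also have "\<dots> = 0"
    by (simp add: cq)
  finally show ?thesis by simp
qed

lemma casimir_eq_e_f:
  "casimir v = e (f v)
     + scale (inverse ((q - inverse q)\<^sup>2)) (scale (inverse q) (k v) + scale q (k' v))"
proof -
  interpret swap: qsl2_action scale q f e k' k by (rule swap)
  show ?thesis
    using casimir_swap[of v] by (simp add: swap.casimir_def add.commute)
qed

text \<open>
  Both sides equal \<open>f e f\<close> plus the same combination of \<open>f k\<close> and \<open>f k'\<close>: moving
  \<open>k\<close> and \<open>k'\<close> past \<open>f\<close> turns the first form of the Casimir element into the second.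
\<close>

lemma casimir_f: "casimir (f v) = f (casimir v)"
proof -
  have cancel: "q * (inverse q * x) = x" for x
    using q_nonzero by (simp flip: mult.assoc)
  show ?thesis
    unfolding casimir_def[of "f v"] casimir_eq_e_f[of v]
    by (simp add: linearity f_k f_k' power2_eq_square scale_right_distrib mult_ac cancel)
qed

lemma casimir_e: "casimir (e v) = e (casimir v)"
proof -
  interpret swap: qsl2_action scale q f e k' k by (rule swap)
  show ?thesis
    using swap.casimir_f[of v] by (simp add: casimir_swap)
qed

lemma casimir_f_pow: "casimir ((f ^^ j) v) = (f ^^ j) (casimir v)"
  by (induction j) (simp_all add: casimir_f)

lemma f_e_on_weight_space:
  assumes "v \<in> weight_space n"
  shows "f (e v) = casimir v - scale (casimir_scalar (n + 1)) v"
  using assms k'_on_weight_space[OF assms] q_nonzero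
  by (simp add: casimir_def casimir_scalar_def weight_space_def power_int_diff power_int_add
      power_int_minus
      scale_right_distrib scale_left_distrib algebra_simps divide_inverse)

lemma e_f_on_weight_space:
  assumes "v \<in> weight_space n"
  shows "e (f v) = casimir v - scale (casimir_scalar (n - 1)) v"
  using assms k'_on_weight_space[OF assms] q_nonzero
  by (simp add: casimir_eq_e_f casimir_scalar_def weight_space_def power_int_diff power_int_add
      power_int_minus
      scale_right_distrib scale_left_distrib algebra_simps divide_inverse)

text \<open>
  If \<open>v\<close> were nonzero, climbing from it with \<open>e\<close> would end in a highest weight vector of weight at least \<open>m\<close>, on which
  the Casimir element takes the value \<open>casimir_scalar (n + 1)\<close> for some \<open>n \<ge> m\<close>. As it commutes
  with \<open>e\<close>, that would also be its value on \<open>v\<close>, but it differs from \<open>casimir_scalar l\<close>.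
\<close>

lemma casimir_eigenvector_zero:
  assumes "v \<in> weight_space m" "(e ^^ j) v = 0"
    and "casimir v = scale (casimir_scalar l) v" "\<bar>l\<bar> < m + 1"
  shows "v = 0"
  using assms
proof (induction j arbitrary: v m)
  case (Suc j)
  have "e v = 0"
  proof (rule Suc.IH)
    show "e v \<in> weight_space (m + 2)"
      using Suc.prems by (simp add: e_weight_space)
    show "(e ^^ j) (e v) = 0"
      using Suc.prems by (simp add: funpow_swap1)
    show "casimir (e v) = scale (casimir_scalar l) (e v)"
      using Suc.prems by (simp add: casimir_e linearity)
  qed (use Suc.prems in simp)
  then have "scale (casimir_scalar l) v = scale (casimir_scalar (m + 1)) v"
    using f_e_on_weight_space[OF Suc.prems(1)] Suc.prems(3) by (simp add: linearity)
  moreover have "casimir_scalar l \<noteq> casimir_scalar (m + 1)"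
    using casimir_scalar_inject[of l "m + 1"] Suc.prems(4) by linarith
  ultimately show ?case
    by simp
qed simp

text \<open>
  On the vectors of weight \<open>m\<close>, \<open>e\<^sup>j f\<^sup>j\<close> is the product of the operators \<open>casimir - casimir_scalar l\<close> with
  \<open>l = m - 1, m - 3, \<dots>, m - 2 j + 1\<close>. For \<open>j \<le> m\<close> all these \<open>l\<close> have absolute value at most
  \<open>m - 1\<close>, so each factor is injective.
\<close>

lemma e_pow_f_pow_injective:
  assumes "v \<in> weight_space (int m)" "j \<le> m" "(e ^^ j) ((f ^^ j) v) = 0"
    and nilpotent: "\<And>w. w \<in> weight_space (int m) \<Longrightarrow> (e ^^ N) w = 0"
  shows "v = 0"
  using assms(1-3)
proof (induction j arbitrary: v)
  case (Suc j)
  define l where "l = int m - 2 * int j - 1"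
  define u where "u = casimir v - scale (casimir_scalar l) v"
  interpret f_pow: Vector_Spaces.linear scale scale "f ^^ j"
    by (rule linear_f_pow)
  have u: "u \<in> weight_space (int m)"
  proof -
    have "u = f (e v) + scale (casimir_scalar (int m + 1) - casimir_scalar l) v"
      using f_e_on_weight_space[OF Suc.prems(1)]
      by (simp add: u_def scale_left_diff_distrib algebra_simps)
    moreover have "f (e v) \<in> weight_space (int m)"
      using f_weight_space[OF e_weight_space[OF Suc.prems(1)]] by simp
    ultimately show ?thesis
      using Suc.prems(1) subspace_weight_space by (simp add: subspace_add subspace_scale)
  qed
  \<comment> \<open>The innermost \<open>e f\<close> of \<open>e\<^bsup>j + 1\<^esup> f\<^bsup>j + 1\<^esup>\<close> acts on \<open>f\<^sup>j v\<close>, which has weight \<open>l + 1\<close>, and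
    becomes a polynomial in the Casimir element, which can be moved to the right past \<open>f\<^sup>j\<close>.\<close>
  have "e (f ((f ^^ j) v)) = (f ^^ j) u"
    using e_f_on_weight_space[OF f_pow_weight_space[OF Suc.prems(1), of j]]
    by (simp add: u_def l_def casimir_f_pow f_pow.diff f_pow.scale algebra_simps)
  then have "(e ^^ j) ((f ^^ j) u) = 0"
    using Suc.prems(3) by (simp add: funpow_swap1)
  then have "u = 0"
    using Suc.IH[OF u] Suc.prems(2) by simp
  then show ?case
    using casimir_eigenvector_zero[OF Suc.prems(1) nilpotent[OF Suc.prems(1)], of l] Suc.prems(2)
    by (simp add: u_def l_def)
qed simp

text \<open>
  The bound \<open>D\<close> on the weights makes \<open>e\<close> and \<open>f\<close> nilpotent. So the composites \<open>e\<^sup>m f\<^sup>m\<close> on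
  weight \<open>m\<close> and \<open>f\<^sup>m e\<^sup>m\<close> on weight \<open>- m\<close> are injective, and in finite dimension surjective.
  Surjectivity of \<open>e\<^sup>m f\<^sup>m\<close> gives, for \<open>w\<close> of weight \<open>- m\<close>, a vector \<open>v\<close> with
  \<open>e\<^sup>m (f\<^sup>m v) = e\<^sup>m w\<close>, and injectivity of \<open>e\<^sup>m\<close> on weight \<open>- m\<close> turns this into \<open>f\<^sup>m v = w\<close>.
\<close>

lemma f_pow_bij_betw_weight_spaces:
  assumes fin_dim
    and bounded: "\<And>n. D < \<bar>n\<bar> \<Longrightarrow> weight_space n = {0}"
  shows "bij_betw (f ^^ m) (weight_space (int m)) (weight_space (- int m))"
proof -
  interpret swap: qsl2_action scale q f e k' k by (rule swap)
  interpret e_pow: Vector_Spaces.linear scale scale "e ^^ m" by (rule linear_e_pow)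
  interpret f_pow: Vector_Spaces.linear scale scale "f ^^ m" by (rule linear_f_pow)
  \<comment> \<open>\<open>Suc (nat D)\<close> steps of size 2 lead from the weight \<open>m \<ge> 0\<close> to a weight above \<open>D\<close>.\<close>
  have nilp: "(e ^^ Suc (nat D)) w = 0" if "w \<in> weight_space (int m)" for w
    using e_pow_weight_space[OF that, of "Suc (nat D)"] bounded[of "int m + 2 * int (Suc (nat D))"]
    by auto
  have nilp': "(f ^^ Suc (nat D)) w = 0" if "w \<in> swap.weight_space (int m)" for w
    using swap.e_pow_weight_space[OF that, of "Suc (nat D)"]
      bounded[of "- (int m + 2 * int (Suc (nat D)))"]
    unfolding weight_space_swap by auto
  have inj: "v = 0" if "v \<in> weight_space (int m)" "(e ^^ m) ((f ^^ m) v) = 0" for v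
    using e_pow_f_pow_injective[OF that(1) _ that(2) nilp] by simp
  have inj': "v = 0" if "v \<in> weight_space (- int m)" "(f ^^ m) ((e ^^ m) v) = 0" for v
    using swap.e_pow_f_pow_injective[OF _ _ that(2) nilp'] that(1) by (simp add: weight_space_swap)
  have f_maps: "(f ^^ m) v \<in> weight_space (- int m)" if "v \<in> weight_space (int m)" for v
    using f_pow_weight_space[OF that, of m] by simp
  have e_maps: "(e ^^ m) v \<in> weight_space (int m)" if "v \<in> weight_space (- int m)" for v
    using e_pow_weight_space[OF that, of m] by simp
  have surj: "(\<lambda>v. (e ^^ m) ((f ^^ m) v)) ` weight_space (int m) = weight_space (int m)"
  proof (rule injective_endomorphism_of_subspace_surj)
    show "Vector_Spaces.linear scale scale (\<lambda>v. (e ^^ m) ((f ^^ m) v))"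
      by (simp add: Vector_Spaces.linear_iff vector_space_axioms
          e_pow.add e_pow.scale f_pow.add f_pow.scale)
  qed (use assms(1) subspace_weight_space inj f_maps e_maps in auto)
  show ?thesis
  proof (rule bij_betw_imageI)
    show "inj_on (f ^^ m) (weight_space (int m))"
    proof (rule inj_onI)
      fix x y assume xy: "x \<in> weight_space (int m)" "y \<in> weight_space (int m)"
        "(f ^^ m) x = (f ^^ m) y"
      then have "x - y = 0"
        by (intro inj[of "x - y"] subspace_diff subspace_weight_space)
          (simp_all add: f_pow.diff e_pow.zero)
      then show "x = y" by simp
    qed
    show "(f ^^ m) ` weight_space (int m) = weight_space (- int m)"
    proof (intro equalityI subsetI)
      fix w assume w: "w \<in> weight_space (- int m)"
      then obtain v where v: "v \<in> weight_space (int m)" "(e ^^ m) ((f ^^ m) v) = (e ^^ m) w"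
        using e_maps[OF w] surj by (metis (no_types, lifting) imageE)
      have "w - (f ^^ m) v = 0"
        using v w f_maps
        by (intro inj'[of "w - (f ^^ m) v"] subspace_diff subspace_weight_space)
          (simp_all add: e_pow.diff f_pow.zero)
      then show "w \<in> (f ^^ m) ` weight_space (int m)"
        using v(1) by auto
    qed (use f_maps in auto)
  qed
qed

end


section \<open>The operators of a module over the quantum affine algebra\<close>

lemma ring_free_ring: "ring (free_ring :: 'k::field free_alg ring)"
proof -
  have "\<exists>y. x + y = 0" for x :: "'k free_alg"
    using add.right_inverse by blast
  then show ?thesis
    unfolding ring_of_type_algebra_def using add.right_inverse
    by unfold_locales (auto simp: algebra_simps Units_def)
qed

lemma free_ring_simps [simp]:
  "carrier (free_ring :: 'k::field free_alg ring) = UNIV"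
  "x \<otimes>\<^bsub>free_ring :: 'k free_alg ring\<^esub> y = x * y"
  "x \<oplus>\<^bsub>free_ring :: 'k free_alg ring\<^esub> y = x + y"
  "\<one>\<^bsub>free_ring :: 'k free_alg ring\<^esub> = 1"
  "\<zero>\<^bsub>free_ring :: 'k free_alg ring\<^esub> = 0"
  by (simp_all add: ring_of_type_algebra_def)

lemma ideal_uq_ideal: "ideal (uq_ideal q) free_ring"
  unfolding uq_ideal_def by (rule ring.genideal_ideal[OF ring_free_ring]) simp

lemma ring_Uq: "ring (Uq q)"
  unfolding Uq_def by (rule ideal.quotient_is_ring[OF ideal_uq_ideal])

lemma uq_class_hom: "uq_class q \<in> ring_hom free_ring (Uq q)"
  using ideal.rcos_ring_hom[OF ideal_uq_ideal[of q]]
  by (simp add: Uq_def uq_class_def[abs_def])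

lemma uq_class_carrier [simp]: "uq_class q x \<in> carrier (Uq q)"
  using ring_hom_closed[OF uq_class_hom] by simp

lemma uq_class_add: "uq_class q (x + y) = uq_class q x \<oplus>\<^bsub>Uq q\<^esub> uq_class q y"
  using ring_hom_add[OF uq_class_hom, of x y] by simp

lemma uq_class_mult: "uq_class q (x * y) = uq_class q x \<otimes>\<^bsub>Uq q\<^esub> uq_class q y"
  using ring_hom_mult[OF uq_class_hom, of x y] by simp

lemma uq_class_one: "uq_class q 1 = \<one>\<^bsub>Uq q\<^esub>"
  using ring_hom_one[OF uq_class_hom, of q] by simp

lemma uq_class_relator:
  assumes "r \<in> uq_relators q"
  shows "uq_class q r = uq_class q 0"
proof -
  have "r \<in> uq_ideal q" "0 \<in> uq_ideal q"
    using assms ring.genideal_self[OF ring_free_ring, of "uq_relators q"]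
      additive_subgroup.zero_closed[OF ideal.axioms(1)[OF ideal_uq_ideal[of q]]]
    by (auto simp: uq_ideal_def)
  then show ?thesis
    unfolding uq_class_def by (simp add: ring.a_rcos_zero[OF ring_free_ring ideal_uq_ideal])
qed

text \<open>This centrality is what makes every element of the algebra act linearly.\<close>

lemma scalar_commute: "x * scalar c = scalar c * (x :: 'k::field free_alg)"
proof -
  have single: "Poly_Mapping.single w a * scalar c = scalar c * Poly_Mapping.single w a"
    for w :: "chevalley word" and a :: 'k
    by (simp add: scalar_def mult_single mult.commute)
  show ?thesis
  proof (induction x rule: Poly_Mapping.update_induct)
    case (update p w a)
    have "Poly_Mapping.update w a p = Poly_Mapping.single w a + p"
      using update.hyps(1)
      by (intro poly_mapping_eqI)
        (auto simp: Poly_Mapping.update.rep_eq lookup_add lookup_single in_keys_iff when_def)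
    then show ?case
      by (simp add: distrib_left distrib_right single update.IH)
  qed simp
qed

locale uq_action = vector_space scale
  for scale :: "'a::field \<Rightarrow> 'b::ab_group_add \<Rightarrow> 'b" +
  fixes q :: 'a and act :: "'a free_alg set \<Rightarrow> 'b \<Rightarrow> 'b"
  assumes uq_module: "uq_module q act"
begin

definition oper :: "'a free_alg \<Rightarrow> 'b \<Rightarrow> 'b" where
  "oper x = act (uq_class q x)"

lemma oper_vector_add: "oper x (v + w) = oper x v + oper x w"
  using uq_module by (simp add: uq_module_def oper_def)

lemma oper_add: "oper (x + y) v = oper x v + oper y v"
  using uq_module by (simp add: uq_module_def oper_def uq_class_add)

lemma oper_mult: "oper (x * y) v = oper x (oper y v)"
  using uq_module by (simp add: uq_module_def oper_def uq_class_mult)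

lemma oper_one: "oper 1 v = v"
  using uq_module by (simp add: uq_module_def oper_def uq_class_one)

lemma oper_scalar: "oper (scalar c) v = scale c v"
  using uq_module by (simp add: uq_module_def oper_def)

lemma oper_diff: "oper (x - y) v = oper x v - oper y v"
  using oper_add[of "x - y" y v] by simp

lemma oper_zero: "oper 0 v = 0"
  using oper_diff[of 0 0 v] by simp

lemma oper_vector_scale: "oper x (scale c v) = scale c (oper x v)"
  by (metis oper_mult oper_scalar scalar_commute)

lemma linear_oper: "Vector_Spaces.linear scale scale (oper x)"
  by (simp add: Vector_Spaces.linear_iff vector_space_axioms oper_vector_add oper_vector_scale)

lemma oper_vector_diff: "oper x (v - w) = oper x v - oper x w"
  using oper_vector_add[of x "v - w" w] by simp

lemma oper_power: "oper (x ^ n) v = (oper x ^^ n) v"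
  by (induction n) (simp_all add: oper_one oper_mult)

lemmas oper_simps = oper_add oper_mult oper_one oper_scalar oper_diff oper_power
  oper_vector_add oper_vector_diff oper_vector_scale

lemma oper_relator: "r \<in> uq_relators q \<Longrightarrow> oper r v = 0"
  using oper_zero[of v] by (simp add: oper_def uq_class_relator)

abbreviation "ep i \<equiv> oper (gen (E Pos i))"
abbreviation "em i \<equiv> oper (gen (E Neg i))"
abbreviation "kp i \<equiv> oper (gen (K Pos i))"
abbreviation "km i \<equiv> oper (gen (K Neg i))"

lemma kp_km: "kp i (km i v) = v"
proof -
  have "gen (K Pos i) * gen (K Neg i) - 1 \<in> uq_relators q"
    unfolding uq_relators_def by blast
  from oper_relator[OF this, of v] show ?thesis
    by (simp add: oper_simps)
qed

lemma km_kp: "km i (kp i v) = v"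
proof -
  have "gen (K Neg i) * gen (K Pos i) - 1 \<in> uq_relators q"
    unfolding uq_relators_def by blast
  from oper_relator[OF this, of v] show ?thesis
    by (simp add: oper_simps)
qed

lemma kp_e: "kp i (oper (gen (E s i)) v) = scale ((pm_power q s)\<^sup>2) (oper (gen (E s i)) (kp i v))"
proof -
  have "gen (K Pos i) * gen (E s i) * gen (K Neg i)
        - scalar ((pm_power q s)\<^sup>2) * gen (E s i) \<in> uq_relators q"
    unfolding uq_relators_def by blast
  from oper_relator[OF this, of "kp i v"] show ?thesis
    by (simp add: oper_simps km_kp)
qed

lemma ep_em: "ep i (em i v) - em i (ep i v) = scale (inverse (q - inverse q)) (kp i v - km i v)"
proof -
  have "gen (E Pos i) * gen (E Neg i) - gen (E Neg i) * gen (E Pos i)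
        - scalar (inverse (q - inverse q)) * (gen (K Pos i) - gen (K Neg i)) \<in> uq_relators q"
    unfolding uq_relators_def by blast
  from oper_relator[OF this, of v] show ?thesis
    by (simp add: oper_simps scale_right_diff_distrib)
qed

lemma q_serre:
  assumes "i \<noteq> j"
  shows "em i (em i (em i (em j v))) - scale (q_number q 3) (em i (em i (em j (em i v))))
       + scale (q_number q 3) (em i (em j (em i (em i v)))) - em j (em i (em i (em i v))) = 0"
proof -
  have "gen (E Neg i) ^ 3 * gen (E Neg j)
        - scalar (q_number q 3) * (gen (E Neg i) ^ 2 * gen (E Neg j) * gen (E Neg i))
        + scalar (q_number q 3) * (gen (E Neg i) * gen (E Neg j) * gen (E Neg i) ^ 2)
        - gen (E Neg j) * gen (E Neg i) ^ 3 \<in> uq_relators q"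
    unfolding uq_relators_def using assms by blast
  from oper_relator[OF this, of v] show ?thesis
    by (simp add: oper_simps numeral_2_eq_2 numeral_3_eq_3)
qed

lemma qsl2_action:
  assumes "q \<noteq> 0" "\<And>n::nat. n > 0 \<Longrightarrow> q ^ n \<noteq> 1"
  shows "qsl2_action scale q (ep i) (em i) (kp i) (km i)"
proof (intro qsl2_action.intro qsl2_action_axioms.intro vector_space_axioms)
  show "kp i (ep i v) = scale (q\<^sup>2) (ep i (kp i v))"
    "kp i (em i v) = scale ((inverse q)\<^sup>2) (em i (kp i v))" for v
    using kp_e[of i Pos] kp_e[of i Neg] by simp_all
qed (fact assms linear_oper kp_km km_kp ep_em)+

lemma kp_commute_trivial_iff:
  "range (act (uq_gen q (K Pos N0) \<otimes>\<^bsub>Uq q\<^esub> uq_gen q (K Pos N1) \<ominus>\<^bsub>Uq q\<^esub> \<one>\<^bsub>Uq q\<^esub>)) = {0}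
     \<longleftrightarrow> (\<forall>v. kp N0 (kp N1 v) = v)"
proof -
  interpret Uq: ring "Uq q" by (rule ring_Uq)
  let ?x = "gen (K Pos N0) * gen (K Pos N1) :: 'a free_alg"
  have "uq_class q (?x - 1) = uq_class q ?x \<ominus>\<^bsub>Uq q\<^esub> \<one>\<^bsub>Uq q\<^esub>"
    using uq_class_add[of q "?x - 1" 1]
    by (simp add: uq_class_one Uq.minus_eq Uq.a_assoc Uq.r_neg)
  then have "act (uq_gen q (K Pos N0) \<otimes>\<^bsub>Uq q\<^esub> uq_gen q (K Pos N1) \<ominus>\<^bsub>Uq q\<^esub> \<one>\<^bsub>Uq q\<^esub>)
      = oper (?x - 1)"
    by (simp add: oper_def uq_class_mult)
  moreover have "oper (?x - 1) v = kp N0 (kp N1 v) - v" for v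
    by (simp add: oper_simps)
  moreover have "range g = {0} \<longleftrightarrow> (\<forall>v. g v = 0)" for g :: "'b \<Rightarrow> 'b"
    by auto
  ultimately show ?thesis
    by simp
qed

text \<open>
  As \<open>K\<^sub>1\<close> acts as the inverse of \<open>K\<^sub>0\<close>, the two subalgebras \<open>U\<^sub>q(sl\<^sub>2)\<close> have the same weight
  spaces with opposite weights: \<open>U i\<close> has weight \<open>2 i - d\<close> for the one with index 0 and weight
  \<open>d - 2 i\<close> for the one with index 1. Hence the lowering operator of the latter raises \<open>i\<close>.
\<close>

lemma basic_if_eigenvalues:
  assumes q: "q \<noteq> 0" "\<And>n::nat. n > 0 \<Longrightarrow> q ^ n \<noteq> 1" and fin: fin_dim
    and kk: "\<And>v. kp N0 (kp N1 v) = v"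
    and diag: "diagonalizable (kp N0)"
    and eig: "eigenvalues (kp N0) = (\<lambda>i. q powi (2 * int i - int d)) ` {..d}"
  shows "basic q d act"
proof -
  have kp_N1: "kp N1 = km N0"
    by (rule ext) (metis kk km_kp)
  have km_N1: "km N1 = kp N0"
    by (rule ext) (metis kp_N1 kp_km km_kp)
  interpret A0: qsl2_action scale q "ep N0" "em N0" "kp N0" "km N0"
    by (rule qsl2_action[OF q])
  interpret A1: qsl2_action scale q "ep N1" "em N1" "km N0" "kp N0"
    using qsl2_action[OF q, of N1] by (simp add: kp_N1 km_N1)
  have A1_weight_space: "A1.weight_space n = A0.weight_space (- n)" for n
    by (rule A0.weight_space_swap)
  define U where "U i = A0.weight_space (2 * int i - int d)" for i
  have bounded: "A0.weight_space n = {0}" if "int d < \<bar>n\<bar>" for n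
  proof -
    have "v = 0" if v: "v \<in> A0.weight_space n" for v
    proof (rule ccontr)
      assume "v \<noteq> 0"
      then have "q powi n \<in> eigenvalues (kp N0)"
        using v by (auto simp: eigenvalues_def A0.weight_space_def)
      then obtain i where "i \<le> d" "n = 2 * int i - int d"
        using eig powi_inject_of_not_root_of_unity[OF q] by auto
      then show False
        using that \<open>int d < \<bar>n\<bar>\<close> by linarith
    qed
    then show ?thesis
      using subspace_0[OF A0.subspace_weight_space] by blast
  qed
  have bounded1: "A1.weight_space n = {0}" if "int d < \<bar>n\<bar>" for n
    using bounded[of "- n"] that by (simp add: A1_weight_space)
  have "inj_on (\<lambda>i. q powi (2 * int i - int d)) {..d}"
    using powi_inject_of_not_root_of_unity[OF q] by (auto simp: inj_on_def)
  from decomposition_eigenspaces[OF linear_oper this diag eig]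
  have "decomposition d U"
    by (simp add: U_def[abs_def] A0.weight_space_def)
  moreover have "\<forall>i\<le>d. \<forall>v\<in>U i. kp N0 v = scale (q powi (2 * int i - int d)) v"
    by (simp add: U_def A0.weight_space_def)
  moreover have R: "em N1 v \<in> U (i + 1)" if "v \<in> U i" for v i
    using that A1.f_weight_space[of v "int d - 2 * int i"]
    by (simp add: U_def A1_weight_space algebra_simps)
  moreover have L: "em N0 v \<in> U (i - 1)" if "v \<in> U i" "1 \<le> i" for v i
    using that A0.f_weight_space[of v "2 * int i - int d"]
    by (simp add: U_def of_nat_diff algebra_simps)
  moreover have "em N1 ` U d = {0}"
  proof -
    have "U (d + 1) = {0}"
      unfolding U_def by (rule bounded) simp
    moreover have "0 \<in> U d"
      unfolding U_def by (rule subspace_0[OF A0.subspace_weight_space])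
    ultimately show ?thesis
      using R[of _ d] A1.f.zero by (auto intro!: image_eqI[of 0 _ 0])
  qed
  moreover have "em N0 ` U 0 = {0}"
  proof -
    have "em N0 v = 0" if "v \<in> U 0" for v
      using A0.f_weight_space[of v "- int d"] that bounded[of "- int d - 2"] by (simp add: U_def)
    moreover have "0 \<in> U 0"
      unfolding U_def by (rule subspace_0[OF A0.subspace_weight_space])
    ultimately show ?thesis
      using A0.f.zero by (auto intro!: image_eqI[of 0 _ 0])
  qed
  moreover have "bij_betw (em N1 ^^ (d - 2 * i)) (U i) (U (d - i))" if "2 * i \<le> d" for i
    using A1.f_pow_bij_betw_weight_spaces[where D = "int d" and m = "d - 2 * i"] fin bounded1 that
    by (simp add: A1_weight_space U_def of_nat_diff algebra_simps)
  moreover have "bij_betw (em N0 ^^ (d - 2 * i)) (U (d - i)) (U i)" if "2 * i \<le> d" for i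
    using A0.f_pow_bij_betw_weight_spaces[where D = "int d" and m = "d - 2 * i"] fin bounded that
    by (simp add: U_def of_nat_diff algebra_simps)
  ultimately have "basic_data q d U (kp N0) (em N1) (em N0)"
    using q_serre[of N1 N0] q_serre[of N0 N1]
    unfolding basic_data_def by (auto simp: linear_oper simp del: One_nat_def)
  moreover have "attached_module q (kp N0) (em N1) (em N0) act"
  proof -
    have "inv_into UNIV (kp N0) = kp N1"
      by (rule inv_equality) (simp_all add: kp_N1 km_kp kp_km)
    then show ?thesis
      using uq_module by (simp add: attached_module_def oper_def)
  qed
  ultimately show ?thesis
    unfolding basic_def by blast
qed

lemma eigenvalues_if_basic:
  assumes "basic q d act"
  shows "\<forall>v. kp N0 (kp N1 v) = v"
    and "diagonalizable (kp N0)"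
    and "eigenvalues (kp N0) = (\<lambda>i. q powi (2 * int i - int d)) ` {..d}"
proof -
  obtain U R L where data: "basic_data q d U (kp N0) R L"
    and att: "attached_module q (kp N0) R L act"
    using assms unfolding basic_def attached_module_def oper_def by blast
  have "surj (kp N0)"
    by (metis kp_km surj_def)
  then show "\<forall>v. kp N0 (kp N1 v) = v"
    using att by (simp add: attached_module_def oper_def surj_f_inv_f)
  show "diagonalizable (kp N0)"
    using data by (intro diagonalizable_of_decomposition[of d U, OF _ linear_oper])
      (auto simp: basic_data_def)
  show "eigenvalues (kp N0) = (\<lambda>i. q powi (2 * int i - int d)) ` {..d}"
    using data by (intro eigenvalues_of_decomposition[of d U, OF _ linear_oper])
      (auto simp: basic_data_def)
qed

end

theorem theorem10p4:
  fixes q :: "'k::alg_closed_field"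
    and scale :: "'k \<Rightarrow> 'v::ab_group_add \<Rightarrow> 'v"
    and act :: "'k free_alg set \<Rightarrow> 'v \<Rightarrow> 'v"
    and d :: nat
  assumes "q \<noteq> 0"
    and "\<And>n::nat. n > 0 \<Longrightarrow> q ^ n \<noteq> 1"
    and "vector_space scale"
    and "vector_space.fin_dim scale"
    and "vector_space.uq_module scale q act"
  shows "vector_space.basic scale q d act \<longleftrightarrow>
    (range (act (uq_gen q (K Pos N0) \<otimes>\<^bsub>Uq q\<^esub> uq_gen q (K Pos N1) \<ominus>\<^bsub>Uq q\<^esub> \<one>\<^bsub>Uq q\<^esub>)) = {0} \<and>
     vector_space.diagonalizable scale (act (uq_gen q (K Pos N0))) \<and>
     vector_space.eigenvalues scale (act (uq_gen q (K Pos N0))) =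
       {q powi (2 * int i - int d) | i. i \<le> d})"
proof -
  interpret vector_space scale by fact
  interpret uq_action scale q act
    using assms(5) by unfold_locales
  have kp: "act (uq_gen q (K Pos N0)) = kp N0"
    by (simp add: oper_def)
  have set: "{q powi (2 * int i - int d) | i. i \<le> d} = (\<lambda>i. q powi (2 * int i - int d)) ` {..d}"
    by auto
  show ?thesis
    unfolding kp_commute_trivial_iff unfolding kp set
    using eigenvalues_if_basic[of d] basic_if_eigenvalues[OF assms(1,2,4), of d] by blast
qed

end
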